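(* For all integers $n\ge k\ge 1$, the varied Ward-Lah numbers $V(n,k)$ satisfy $$V(n,k)=2n(2n-1)\Big(V(n-1,k)+V(n-1,k-1)\Big).$$
   Context: Partition transformation: for integers $n,k\ge 0$ and a sequence $a_1,a_2,\dots$, $$P_n^k(a_1,a_2,\dots)=\sum_{q}(-1)^{q_0}\prod_{j=0}^{\ell(q)-1}\binom{q_j}{q_{j+1}}a_{j+1}^{q_j},$$ where the sum is over integer partitions $q=(q_0\ge q_1\ge\dots)$ of $n=q_0+q_1+\cdots$ with $q_0=k$; $\ell(q)$ is the length of $q$ (number of positive parts), so $q_{\ell(q)-1}>0$ and $q_{\ell(q)}=0$. Varied Ward-Lah numbers: for integers $n\ge k\ge 0$, $V(n,k)=(-1)^k (2n)!\,P_n^k(1,1,\dots)$ (all $a_i=1$), with $V(0,0)=1$, $V(n,0)=0$ for $n\ge 1$, $V(0,k)=0$ for $k\ge 1$, and $V(n,k)=0$ for $k>n$. *)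

theory Defs
  imports Complex_Main
begin

text \<open>An integer partition \<open>q\<^sub>0 \<ge> q\<^sub>1 \<ge> \<dots>\<close> of \<open>n\<close> is encoded as a weakly decreasing, finitely
  supported sequence; the trailing zeros are the convention \<open>q\<^sub>j = 0\<close> for \<open>j \<ge> \<ell>(q)\<close>.
  In particular the empty partition is the zero sequence.\<close>

definition partitions :: "nat \<Rightarrow> (nat \<Rightarrow> nat) set" where
  "partitions n = {q. decseq q \<and> finite {j. q j > 0} \<and> (\<Sum>j | q j > 0. q j) = n}"

definition part_length :: "(nat \<Rightarrow> nat) \<Rightarrow> nat" where
  "part_length q = card {j. q j > 0}"

text \<open>The argument sequence \<open>a\<^sub>1, a\<^sub>2, \<dots>\<close> is indexed from 1; the value \<open>a 0\<close> is not used.\<close>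

definition P :: "nat \<Rightarrow> nat \<Rightarrow> (nat \<Rightarrow> 'a::comm_ring_1) \<Rightarrow> 'a" where
  "P n k a = (\<Sum>q \<in> {q \<in> partitions n. q 0 = k}.
     (-1) ^ q 0 * (\<Prod>j<part_length q. of_nat (q j choose q (j + 1)) * a (j + 1) ^ q j))"

text \<open>The boundary values usually listed with this definition (\<open>V 0 0 = 1\<close>, and \<open>V n k = 0\<close> if
  \<open>k = 0 < n\<close> or \<open>k > n\<close>) are consequences of it, proved below.\<close>

definition V :: "nat \<Rightarrow> nat \<Rightarrow> int" where
  "V n k = (-1) ^ k * fact (2 * n) * P n k (\<lambda>_. 1)"

lemma partitions_le:
  assumes "q \<in> partitions n"
  shows "q j \<le> n"
proof (cases "q j > 0")
  case True
  then have "q j \<le> (\<Sum>j | q j > 0. q j)"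
    using assms by (intro member_le_sum) (auto simp: partitions_def)
  then show ?thesis using assms by (simp add: partitions_def)
qed simp

lemma partitions_eq_0:
  assumes "q \<in> partitions n" "j \<ge> n"
  shows "q j = 0"
proof (rule ccontr)
  assume "q j \<noteq> 0"
  have dec: "decseq q" and fin: "finite {j. q j > 0}" and s: "(\<Sum>j | q j > 0. q j) = n"
    using assms(1) by (auto simp: partitions_def)
  have pos: "q i > 0" if "i \<le> j" for i
    using decseqD[OF dec that] \<open>q j \<noteq> 0\<close> by linarith
  have "Suc j = (\<Sum>i\<le>j. 1)" by simp
  also have "\<dots> \<le> (\<Sum>i\<le>j. q i)" by (intro sum_mono) (use pos in \<open>auto simp: Suc_le_eq\<close>)
  also have "\<dots> \<le> (\<Sum>j | q j > 0. q j)" using fin pos by (intro sum_mono2) auto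
  finally show False using s assms(2) by simp
qed

text \<open>The sum in the definition of \<open>P\<close> is therefore a genuine finite sum.\<close>

lemma finite_partitions: "finite (partitions n)"
proof (rule finite_subset)
  show "partitions n \<subseteq> {q. \<forall>j. (j \<in> {..<n} \<longrightarrow> q j \<in> {..n}) \<and> (j \<notin> {..<n} \<longrightarrow> q j = 0)}"
    using partitions_le partitions_eq_0 by (auto simp: not_less)
  show "finite {q :: nat \<Rightarrow> nat. \<forall>j. (j \<in> {..<n} \<longrightarrow> q j \<in> {..n}) \<and> (j \<notin> {..<n} \<longrightarrow> q j = 0)}"
    by (rule finite_set_of_finite_funs) auto
qed

lemma partitions_first_0:
  "{q \<in> partitions n. q 0 = 0} = (if n = 0 then {\<lambda>_. 0} else {})"
proof -
  have "q = (\<lambda>_. 0)" if "q \<in> partitions n" "q 0 = 0" for q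
  proof
    fix j show "q j = 0" using that decseqD[of q 0 j] by (simp add: partitions_def)
  qed
  moreover have "(\<lambda>_. 0) \<in> partitions n \<longleftrightarrow> n = 0"
    by (auto simp: partitions_def decseq_def)
  ultimately show ?thesis by auto
qed

lemma V_0_0: "V 0 0 = 1"
  by (simp add: V_def P_def partitions_first_0 part_length_def)

lemma V_n_0: "n \<ge> 1 \<Longrightarrow> V n 0 = 0"
  by (simp add: V_def P_def partitions_first_0)

lemma V_gt: "k > n \<Longrightarrow> V n k = 0"
proof -
  assume "k > n"
  then have "{q \<in> partitions n. q 0 = k} = {}"
    using partitions_le[of _ n 0] by fastforce
  then show ?thesis unfolding V_def P_def by (simp only: sum.empty mult_zero_right)
qed

end

(* Removing the first part q_0 = k of a partition gives a recurrence for P_n^k. For a_i = 1 it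
   reads W(n,k) = sum_m (k choose m) W(n-k,m) with W = (-1)^k P, and Vandermonde's identity shows
   that it is solved by W(n,k) = (n-1 choose k-1), the number of compositions of n into k parts.
   The claim is then Pascal's rule times (2n)! = 2n (2n-1) (2n-2)!. *)
theory Submission
  imports Defs
begin

text \<open>\<open>case_nat k r\<close> prepends \<open>k\<close> to the sequence \<open>r\<close>,
  which undoes the removal of a first part; the recurrence for \<open>P\<close> rests on this
  map.\<close>

lemma decseq_case_nat_iff:
  "decseq (case_nat k r) \<longleftrightarrow> decseq r \<and> r 0 \<le> (k :: nat)"
proof -
  have "(\<forall>j. Q j) \<longleftrightarrow> Q 0 \<and> (\<forall>j. Q (Suc j))" for Q
    by (metis not0_implies_Suc)
  from this[of "\<lambda>j. case_nat k r (Suc j) \<le> case_nat k r j"] show ?thesis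
    by (auto simp: decseq_Suc_iff)
qed

lemma support_case_nat:
  assumes "k > 0"
  shows "{j. case_nat k r j > (0 :: nat)} = insert 0 (Suc ` {j. r j > 0})"
proof (rule set_eqI)
  fix j show "j \<in> {j. case_nat k r j > 0} \<longleftrightarrow> j \<in> insert 0 (Suc ` {j. r j > 0})"
    using assms by (cases j) auto
qed

lemma part_length_case_nat:
  assumes "k > 0" "finite {j. r j > 0}"
  shows "part_length (case_nat k r) = Suc (part_length r)"
  using assms by (simp add: part_length_def support_case_nat card_image)

lemma case_nat_in_partitions_iff:
  assumes "k > 0" "k \<le> n"
  shows "case_nat k r \<in> partitions n \<longleftrightarrow> r \<in> partitions (n - k) \<and> r 0 \<le> k"
proof (cases "finite {j. r j > 0}")
  case True
  then have "(\<Sum>j | case_nat k r j > 0. case_nat k r j) = k + (\<Sum>j | r j > 0. r j)"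
    using assms by (simp add: support_case_nat sum.reindex)
  then show ?thesis using assms True
    by (auto simp: partitions_def decseq_case_nat_iff support_case_nat)
next
  \<comment> \<open>Prepending one entry cannot make an infinite support finite, so both sides
    fail.\<close>
  case False
  then show ?thesis using assms
    by (simp add: partitions_def support_case_nat finite_image_iff)
qed

text \<open>The tails are grouped by their own first part \<open>m\<close>, so that each group is
  the index set of some \<open>P (n - k) m\<close>.\<close>

lemma partitions_first_Suc:
  assumes "k > 0" "k \<le> n"
  shows "{q \<in> partitions n. q 0 = k} = case_nat k ` (\<Union>m\<le>k. {r \<in> partitions (n - k). r 0 = m})"
proof (intro equalityI subsetI)
  fix q assume q: "q \<in> {q \<in> partitions n. q 0 = k}"
  then have eq: "q = case_nat k (\<lambda>j. q (Suc j))" by (auto split: nat.splits)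
  with q have "case_nat k (\<lambda>j. q (Suc j)) \<in> partitions n" by simp
  then have "(\<lambda>j. q (Suc j)) \<in> (\<Union>m\<le>k. {r \<in> partitions (n - k). r 0 = m})"
    using assms by (simp add: case_nat_in_partitions_iff)
  then show "q \<in> case_nat k ` (\<Union>m\<le>k. {r \<in> partitions (n - k). r 0 = m})"
    by (subst eq) (rule imageI)
qed (use assms in \<open>auto simp: case_nat_in_partitions_iff\<close>)

text \<open>The factor for \<open>j = 0\<close> depends only on \<open>k\<close> and the second part
  \<open>m\<close>, and the other factors form the product of the tail with the arguments shifted by
  one. For constant arguments the shift changes nothing and the recurrence closes.\<close>

lemma P_rec:
  fixes a :: "nat \<Rightarrow> 'a::comm_ring_1"
  assumes "k > 0" "k \<le> n"
  shows "P n k a = (- a 1) ^ k *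
    (\<Sum>m\<le>k. of_nat (k choose m) * (-1) ^ m * P (n - k) m (\<lambda>j. a (Suc j)))"
proof -
  define t where "t b q = (\<Prod>j<part_length q. of_nat (q j choose q (j + 1)) * b (j + 1) ^ q j)"
    for b :: "nat \<Rightarrow> 'a" and q
  define b where "b j = a (Suc j)" for j
  define R where "R m = {r \<in> partitions (n - k). r 0 = m}" for m
  have inj: "inj_on (case_nat k) A" for A :: "(nat \<Rightarrow> nat) set"
    by (rule inj_onI) (metis nat.case(2) ext)
  \<comment> \<open>The product must be split at its first factor; the default simp rule would split
    off the last.\<close>
  have t: "t a (case_nat k r) = of_nat (k choose m) * a 1 ^ k * t b r" if "r \<in> R m" for r m
    using that assms
    by (auto simp: t_def R_def b_def partitions_def part_length_case_nat prod.lessThan_Suc_shift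
             simp del: prod.lessThan_Suc)
  have "P n k a = (\<Sum>q \<in> case_nat k ` (\<Union>m\<le>k. R m). (-1) ^ k * t a q)"
    unfolding P_def t_def R_def partitions_first_Suc[OF assms, symmetric]
    by (intro sum.cong) auto
  also have "\<dots> = (\<Sum>r \<in> (\<Union>m\<le>k. R m). (-1) ^ k * t a (case_nat k r))"
    by (simp add: sum.reindex[OF inj])
  also have "\<dots> = (\<Sum>m\<le>k. \<Sum>r \<in> R m. (-1) ^ k * t a (case_nat k r))"
    by (rule sum.UNION_disjoint) (auto simp: R_def finite_partitions)
  also have "\<dots> = (\<Sum>m\<le>k. (- a 1) ^ k * (of_nat (k choose m) * (-1) ^ m * P (n - k) m b))"
  proof (rule sum.cong)
    fix m
    have P: "P (n - k) m b = (\<Sum>r \<in> R m. (-1) ^ m * t b r)"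
      unfolding P_def t_def R_def by (intro sum.cong) auto
    \<comment> \<open>The summand of \<open>P\<close> carries the sign of its own first part
      \<open>m\<close>; the extra \<open>(-1) ^ m\<close> in the recurrence cancels it.\<close>
    have sq: "(-1) ^ m * ((-1) ^ m * x) = x" for x :: 'a
      by (simp flip: mult.assoc power_mult_distrib)
    have "(\<Sum>r \<in> R m. (-1) ^ k * t a (case_nat k r))
        = (\<Sum>r \<in> R m. (- a 1) ^ k * of_nat (k choose m) * t b r)"
      by (intro sum.cong refl) (simp add: t power_minus[of "a (Suc 0)" k] ac_simps)
    then show "(\<Sum>r \<in> R m. (-1) ^ k * t a (case_nat k r))
        = (- a 1) ^ k * (of_nat (k choose m) * (-1) ^ m * P (n - k) m b)"
      by (simp add: P sq mult.assoc flip: sum_distrib_left)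
  qed simp
  finally show ?thesis
    by (simp add: b_def[abs_def] sum_distrib_left)
qed

lemma P_0: "P n 0 a = (if n = 0 then 1 else 0)"
  by (simp add: P_def partitions_first_0 part_length_def)

lemma P_gt:
  assumes "k > n"
  shows "P n k a = 0"
proof -
  have "{q \<in> partitions n. q 0 = k} = {}"
    using assms partitions_le[of _ n 0] by fastforce
  then show ?thesis unfolding P_def by (simp only: sum.empty)
qed

text \<open>Removing the first part leaves \<open>n - k\<close>, and \<open>m\<close> varies in the
  sum, hence strong induction with \<open>k\<close> arbitrary. The successors avoid truncated
  subtraction in the binomial.\<close>

lemma P_ones:
  "P (Suc n) (Suc k) (\<lambda>_. 1 :: 'a::comm_ring_1) = (-1) ^ Suc k * of_nat (n choose k)"
proof (induction n arbitrary: k rule: less_induct)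
  case (less n)
  consider "k > n" | "k = n" | "k < n" by linarith
  then show ?case
  proof cases
    case 1
    then show ?thesis by (simp add: P_gt binomial_eq_0)
  next
    case 2
    \<comment> \<open>Nothing remains after the first part, so only the empty tail,
      \<open>m = 0\<close>, contributes.\<close>
    have "(\<Sum>m\<le>Suc n. of_nat (Suc n choose m) * (-1) ^ m * P 0 m (\<lambda>_. 1 :: 'a)) = 1"
      by (subst sum.atMost_Suc_shift) (simp add: P_0 P_gt)
    with 2 show ?thesis by (simp add: P_rec)
  next
    case 3
    define N where "N = n - Suc k"
    have N: "Suc n - Suc k = Suc N" "N < n" "Suc k + N = n" using 3 by (auto simp: N_def)
    have sq: "(-1) ^ m * ((-1) ^ m * x) = x" for m and x :: 'a
      by (simp flip: mult.assoc power_mult_distrib)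
    \<comment> \<open>The term \<open>m = 0\<close> vanishes because \<open>Suc N\<close> is
      positive; the shifted terms have the form of the induction hypothesis.\<close>
    have "(\<Sum>m\<le>Suc k. of_nat (Suc k choose m) * (-1) ^ m * P (Suc N) m (\<lambda>_. 1 :: 'a))
        = (\<Sum>m\<le>k. of_nat ((Suc k choose Suc m) * (N choose m)))"
      by (subst sum.atMost_Suc_shift)
         (simp add: P_0 less.IH[OF N(2)] sq mult.assoc del: binomial_Suc_Suc)
    \<comment> \<open>Symmetry of \<open>Suc k choose Suc m\<close> makes the lower indices add up
      to \<open>k\<close>, as Vandermonde's identity requires.\<close>
    also have "\<dots> = of_nat (\<Sum>m\<le>k. (N choose m) * (Suc k choose (k - m)))"
      unfolding of_nat_sum
    proof (intro sum.cong refl)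
      fix m assume "m \<in> {..k}"
      then have "Suc k choose Suc m = Suc k choose (k - m)"
        using binomial_symmetric[of "Suc m" "Suc k"] by simp
      then show "(of_nat ((Suc k choose Suc m) * (N choose m)) :: 'a)
          = of_nat ((N choose m) * (Suc k choose (k - m)))" by (simp only: mult.commute)
    qed
    also have "\<dots> = of_nat (n choose k)"
      using N(3) vandermonde[of N "Suc k" k] by (simp only: add.commute)
    finally show ?thesis using 3 by (simp only: P_rec N(1))
  qed
qed

lemma V_Suc_Suc: "V (Suc n) (Suc k) = fact (2 * Suc n) * int (n choose k)"
  unfolding V_def P_ones by (simp flip: mult.assoc power_mult_distrib)

theorem theorem4p5:
  fixes n k :: nat
  assumes "n \<ge> k" and "k \<ge> 1"
  shows "V n k = 2 * int n * (2 * int n - 1) * (V (n - 1) k + V (n - 1) (k - 1))"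
proof -
  obtain n' k' where nk: "n = Suc n'" "k = Suc k'"
    using assms by (metis Suc_le_D One_nat_def le_trans)
  have fact: "fact (2 * n) = 2 * int n * (2 * int n - 1) * fact (2 * n')"
    by (simp add: nk algebra_simps)
  \<comment> \<open>Pascal's rule if \<open>n'\<close> and \<open>k'\<close> are positive. The
    closed form does not cover a zero index, so those cases use the boundary values;
    \<open>n' = 0\<close> forces \<open>k' = 0\<close>.\<close>
  have "V n' k + V n' k' = fact (2 * n') * int (n' choose k')"
  proof (cases n')
    case 0
    then show ?thesis using assms by (simp add: nk V_gt V_0_0)
  next
    case (Suc i)
    then show ?thesis
      by (cases k') (simp_all add: nk V_Suc_Suc V_n_0 algebra_simps del: fact_Suc mult_Suc_right)
  qed
  then show ?thesis
    unfolding nk V_Suc_Suc using fact by (simp add: nk del: fact_Suc mult_Suc_right)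
qed

end
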